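(* Let $\kappa$ be a cardinal and $U$ an ultrafilter over $\kappa$. Then the collection of $U$-null subsets of ${}^{\omega}\kappa$ is a $\sigma$-ideal: every subset of a $U$-null set is $U$-null, and the union of countably many $U$-null sets is $U$-null.
   Context: ${}^{\omega}\kappa$ is the set of functions $\omega\to\kappa$ and ${}^{<\omega}\kappa$ the set of finite sequences from $\kappa$; $\frown$ denotes concatenation and $\langle\rangle$ the empty sequence. A tree is a subset $T\subseteq {}^{<\omega}\kappa$ closed under initial segments, and $[T]$ is the set of $s\in{}^{\omega}\kappa$ all of whose finite initial segments lie in $T$. For $X\subseteq{}^{\omega}\kappa$ and $\sigma\in{}^{<\omega}\kappa$, $X\lfloor\sigma=\{s\in{}^{\omega}\kappa: \sigma\frown s\in X\}$. A tree $T$ is $U$-branching iff $\langle\rangle\in T$ and for every $\sigma\in T$, $\{\alpha\in\kappa:\sigma\frown\langle\alpha\rangle\in T\}\in U$. A set $X\subseteq{}^{\omega}\kappa$ is $U$-small iff there is a $U$-branching tree $T$ with $[T]\cap X=\emptyset$. $X$ is $U$-null iff $X\lfloor\sigma$ is $U$-small for every $\sigma\in{}^{<\omega}\kappa$. *)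

theory Defs
  imports
    Main
    "HOL-Library.FuncSet"
    "HOL-Library.Countable_Set"
    "HOL-Library.Sublist"
    "HOL-Library.Omega_Words_Fun"
begin

(* K is the underlying set of the cardinal \<kappa>; the finite sequences from \<kappa> are
   the members of lists K. *)

definition ultrafilter_over :: "'a set \<Rightarrow> 'a set set \<Rightarrow> bool" where
  "ultrafilter_over K U \<longleftrightarrow>
     U \<subseteq> Pow K \<and> K \<in> U \<and> {} \<notin> U \<and>
     (\<forall>A\<in>U. \<forall>B\<in>U. A \<inter> B \<in> U) \<and>
     (\<forall>A\<in>U. \<forall>B. A \<subseteq> B \<and> B \<subseteq> K \<longrightarrow> B \<in> U) \<and>
     (\<forall>A. A \<subseteq> K \<longrightarrow> A \<in> U \<or> K - A \<in> U)"

definition omega_seqs :: "'a set \<Rightarrow> (nat \<Rightarrow> 'a) set" where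
  "omega_seqs K = (UNIV \<rightarrow> K)"

definition seq_tree :: "'a set \<Rightarrow> 'a list set \<Rightarrow> bool" where
  "seq_tree K T \<longleftrightarrow>
     T \<subseteq> lists K \<and> (\<forall>\<tau>\<in>T. \<forall>\<sigma>. Sublist.prefix \<sigma> \<tau> \<longrightarrow> \<sigma> \<in> T)"

definition branches :: "'a set \<Rightarrow> 'a list set \<Rightarrow> (nat \<Rightarrow> 'a) set" where
  "branches K T = {s \<in> omega_seqs K. \<forall>n. Omega_Words_Fun.prefix n s \<in> T}"

definition section_at :: "'a set \<Rightarrow> (nat \<Rightarrow> 'a) set \<Rightarrow> 'a list \<Rightarrow> (nat \<Rightarrow> 'a) set" where
  "section_at K X \<sigma> = {s \<in> omega_seqs K. \<sigma> \<frown> s \<in> X}"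

definition U_branching :: "'a set \<Rightarrow> 'a set set \<Rightarrow> 'a list set \<Rightarrow> bool" where
  "U_branching K U T \<longleftrightarrow>
     seq_tree K T \<and> [] \<in> T \<and> (\<forall>\<sigma>\<in>T. {\<alpha> \<in> K. \<sigma> @ [\<alpha>] \<in> T} \<in> U)"

definition U_small :: "'a set \<Rightarrow> 'a set set \<Rightarrow> (nat \<Rightarrow> 'a) set \<Rightarrow> bool" where
  "U_small K U X \<longleftrightarrow>
     X \<subseteq> omega_seqs K \<and> (\<exists>T. U_branching K U T \<and> branches K T \<inter> X = {})"

definition U_null :: "'a set \<Rightarrow> 'a set set \<Rightarrow> (nat \<Rightarrow> 'a) set \<Rightarrow> bool" where
  "U_null K U X \<longleftrightarrow>
     X \<subseteq> omega_seqs K \<and> (\<forall>\<sigma>\<in>lists K. U_small K U (section_at K X \<sigma>))"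

(* Properness (S \<notin> I) is not part of the notion.  The empty set is in I by taking F = {}. *)
definition sigma_ideal_on :: "'b set \<Rightarrow> 'b set set \<Rightarrow> bool" where
  "sigma_ideal_on S I \<longleftrightarrow>
     I \<subseteq> Pow S \<and>
     (\<forall>X\<in>I. \<forall>Y. Y \<subseteq> X \<longrightarrow> Y \<in> I) \<and>
     (\<forall>F. countable F \<and> F \<subseteq> I \<longrightarrow> \<Union>F \<in> I)"

end

theory Submission
  imports Defs
begin

text \<open>
  Given null sets \<open>X\<^sub>0, X\<^sub>1, \<dots>\<close>, fuse the witnessing trees: for a node \<open>\<sigma>\<close> of length \<open>n\<close>,
  choose a \<open>U\<close>-branching tree \<open>T n \<sigma>\<close> avoiding the section of \<open>X\<^sub>n\<close> at \<open>\<sigma>\<close>, and let a node \<open>\<tau>\<close>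
  survive if for every \<open>k \<le> length \<tau>\<close> its part after the first \<open>k\<close> entries lies in \<open>T k (take k \<tau>)\<close>.
  The tree for \<open>X\<^sub>n\<close> starts to matter only at level \<open>n\<close>, so each node is subject to finitely many
  constraints and filter closure under finite intersections suffices for \<open>U\<close>-branching.
\<close>

lemma take_prefix_eq_prefix:
  "k \<le> n \<Longrightarrow> take k (Omega_Words_Fun.prefix n s) = Omega_Words_Fun.prefix k s"
  by (simp add: take_map take_upt)

lemma drop_prefix_eq_prefix_suffix:
  "drop k (Omega_Words_Fun.prefix (k + n) s) = Omega_Words_Fun.prefix n (suffix k s)"
  by (rule nth_equalityI) (auto simp: suffix_def)

lemma suffix_in_omega_seqs: "s \<in> omega_seqs K \<Longrightarrow> suffix n s \<in> omega_seqs K"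
  by (auto simp: omega_seqs_def suffix_def)

lemma conc_in_omega_seqs:
  "\<sigma> \<in> lists K \<Longrightarrow> s \<in> omega_seqs K \<Longrightarrow> \<sigma> \<frown> s \<in> omega_seqs K"
  by (auto simp: omega_seqs_def conc_def in_lists_conv_set)

lemma prefix_in_lists: "s \<in> omega_seqs K \<Longrightarrow> Omega_Words_Fun.prefix n s \<in> lists K"
  by (auto simp: omega_seqs_def Pi_iff)

text \<open>\<open>I\<close> is nonempty because an empty intersection would be \<open>UNIV\<close>,
  which need not be a subset of \<open>K\<close>.\<close>

lemma ultrafilter_over_finite_INT:
  assumes "ultrafilter_over K U" and "finite I" and "I \<noteq> {}" and "\<And>i. i \<in> I \<Longrightarrow> A i \<in> U"
  shows "(\<Inter>i\<in>I. A i) \<in> U"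
  using assms(2-4)
proof (induction I rule: finite_ne_induct)
  case (insert i I)
  then show ?case using assms(1) by (simp add: ultrafilter_over_def)
qed simp

lemma section_at_section_at:
  assumes "\<tau> \<in> lists K"
  shows "section_at K (section_at K X \<sigma>) \<tau> = section_at K X (\<sigma> @ \<tau>)"
  using conc_in_omega_seqs[OF assms] by (auto simp: section_at_def)

lemma section_at_UN: "section_at K (\<Union>i\<in>I. X i) \<sigma> = (\<Union>i\<in>I. section_at K (X i) \<sigma>)"
  by (auto simp: section_at_def)

text \<open>A section of a section is the section at the concatenated sequence. This later moves the
  argument for unions from the root to an arbitrary \<sigma>.\<close>

lemma U_null_section_at: "U_null K U X \<Longrightarrow> \<sigma> \<in> lists K \<Longrightarrow> U_null K U (section_at K X \<sigma>)"
  unfolding U_null_def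
  by (auto simp: section_at_section_at) (simp add: section_at_def)

lemma U_small_subset: "U_small K U X \<Longrightarrow> Y \<subseteq> X \<Longrightarrow> U_small K U Y"
  unfolding U_small_def by blast

lemma U_null_subset:
  assumes "U_null K U X" and "Y \<subseteq> X"
  shows "U_null K U Y"
proof -
  have "section_at K Y \<sigma> \<subseteq> section_at K X \<sigma>" for \<sigma>
    using assms(2) by (auto simp: section_at_def)
  then show ?thesis
    using assms unfolding U_null_def by (blast intro: U_small_subset)
qed

text \<open>The full tree is a witness, since \<open>K \<in> U\<close>. The empty set will pad the
  enumeration of a countable family.\<close>

lemma U_null_empty:
  assumes "ultrafilter_over K U"
  shows "U_null K U {}"
proof -
  have "U_branching K U (lists K)"
    using assms by (auto simp: U_branching_def seq_tree_def ultrafilter_over_def Sublist.prefix_def)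
  then show ?thesis
    by (auto simp: U_null_def U_small_def section_at_def)
qed

definition fusion_tree :: "'a set \<Rightarrow> (nat \<Rightarrow> 'a list \<Rightarrow> 'a list set) \<Rightarrow> 'a list set" where
  "fusion_tree K T = {\<tau> \<in> lists K. \<forall>k\<le>length \<tau>. drop k \<tau> \<in> T k (take k \<tau>)}"

lemma U_branching_fusion_tree:
  assumes U: "ultrafilter_over K U"
    and T: "\<And>n \<sigma>. \<sigma> \<in> lists K \<Longrightarrow> U_branching K U (T n \<sigma>)"
  shows "U_branching K U (fusion_tree K T)"
  unfolding U_branching_def seq_tree_def
proof (intro conjI ballI allI impI)
  show "fusion_tree K T \<subseteq> lists K"
    by (auto simp: fusion_tree_def)
  show "[] \<in> fusion_tree K T"
    using T[of "[]"] by (simp add: fusion_tree_def U_branching_def)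
next
  fix \<tau> \<sigma> assume \<tau>: "\<tau> \<in> fusion_tree K T" and "Sublist.prefix \<sigma> \<tau>"
  then obtain \<rho> where \<rho>: "\<tau> = \<sigma> @ \<rho>"
    by (auto simp: Sublist.prefix_def)
  have "drop k \<sigma> \<in> T k (take k \<sigma>)" if k: "k \<le> length \<sigma>" for k
  proof -
    \<comment> \<open>As \<open>k \<le> length \<sigma>\<close>, the k-th constraints on \<sigma>
      and \<tau> refer to the same tree, which is closed under initial segments.\<close>
    have "drop k \<sigma> @ \<rho> \<in> T k (take k \<sigma>)"
      using \<tau> k unfolding fusion_tree_def \<rho> by (auto dest!: spec[of _ k])
    moreover have "take k \<sigma> \<in> lists K"
      using \<tau> \<rho> by (auto simp: fusion_tree_def in_lists_conv_set dest: in_set_takeD)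
    ultimately show ?thesis
      using T[of "take k \<sigma>" k] unfolding U_branching_def seq_tree_def by (meson prefixI)
  qed
  then show "\<sigma> \<in> fusion_tree K T"
    using \<tau> \<rho> by (auto simp: fusion_tree_def)
next
  fix \<tau> assume \<tau>: "\<tau> \<in> fusion_tree K T"
  then have \<tau>K: "\<tau> \<in> lists K"
    by (simp add: fusion_tree_def)
  then have takeK: "take k \<tau> \<in> lists K" for k
    by (auto simp: in_lists_conv_set dest: in_set_takeD)
  \<comment> \<open>The successors that the k-th tree allows at \<tau>; appending \<alpha> leaves
    \<open>take k \<tau>\<close>, and hence the tree, unchanged.\<close>
  let ?A = "\<lambda>k. {\<alpha> \<in> K. drop k \<tau> @ [\<alpha>] \<in> T k (take k \<tau>)}"
  have "?A k \<in> U" if "k \<le> length \<tau>" for k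
    using T[OF takeK, of k k] \<tau> that by (auto simp: U_branching_def fusion_tree_def)
  then have "(\<Inter>k\<in>{..length \<tau>}. ?A k) \<in> U"
    by (intro ultrafilter_over_finite_INT[OF U]) auto
  moreover have "(\<Inter>k\<in>{..length \<tau>}. ?A k) = {\<alpha> \<in> K. \<tau> @ [\<alpha>] \<in> fusion_tree K T}"
  proof (intro set_eqI iffI)
    fix \<alpha> assume \<alpha>: "\<alpha> \<in> (\<Inter>k\<in>{..length \<tau>}. ?A k)"
    then have "\<alpha> \<in> K" by auto
    have "drop k (\<tau> @ [\<alpha>]) \<in> T k (take k (\<tau> @ [\<alpha>]))" if "k \<le> Suc (length \<tau>)" for k
    proof (cases "k = Suc (length \<tau>)")
      \<comment> \<open>Here the tree in question starts at the new node itself: the dropped part is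
        \<open>[]\<close>, the root of that tree, so \<alpha> is not restricted further.\<close>
      case True
      then show ?thesis
        using T[of "\<tau> @ [\<alpha>]" k] \<tau>K \<open>\<alpha> \<in> K\<close> by (simp add: U_branching_def)
    next
      case False
      then show ?thesis using \<alpha> that by auto
    qed
    then show "\<alpha> \<in> {\<alpha> \<in> K. \<tau> @ [\<alpha>] \<in> fusion_tree K T}"
      using \<tau>K \<open>\<alpha> \<in> K\<close> by (simp add: fusion_tree_def)
  next
    fix \<alpha> assume "\<alpha> \<in> {\<alpha> \<in> K. \<tau> @ [\<alpha>] \<in> fusion_tree K T}"
    then have "\<alpha> \<in> K"
      and *: "\<forall>k\<le>Suc (length \<tau>). drop k (\<tau> @ [\<alpha>]) \<in> T k (take k (\<tau> @ [\<alpha>]))"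
      by (simp_all add: fusion_tree_def)
    have "drop k \<tau> @ [\<alpha>] \<in> T k (take k \<tau>)" if "k \<le> length \<tau>" for k
      using *[rule_format, of k] that by simp
    then show "\<alpha> \<in> (\<Inter>k\<in>{..length \<tau>}. ?A k)"
      using \<open>\<alpha> \<in> K\<close> by simp
  qed
  ultimately show "{\<alpha> \<in> K. \<tau> @ [\<alpha>] \<in> fusion_tree K T} \<in> U"
    by simp
qed

text \<open>Fix the constraint \<open>k = n\<close> and apply it to the initial segments of
  \<open>s\<close> of length \<open>n + m\<close>, for all \<open>m\<close>.\<close>

lemma suffix_in_branches_if_fusion_tree:
  assumes "s \<in> branches K (fusion_tree K T)"
  shows "suffix n s \<in> branches K (T n (Omega_Words_Fun.prefix n s))"
proof -
  have "Omega_Words_Fun.prefix m (suffix n s) \<in> T n (Omega_Words_Fun.prefix n s)" for m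
  proof -
    let ?p = "Omega_Words_Fun.prefix (n + m) s"
    have "?p \<in> fusion_tree K T" and "n \<le> length ?p"
      using assms by (auto simp: branches_def)
    then have "drop n ?p \<in> T n (take n ?p)"
      unfolding fusion_tree_def by blast
    then show ?thesis
      by (simp only: drop_prefix_eq_prefix_suffix take_prefix_eq_prefix le_add1)
  qed
  then show ?thesis
    using assms by (auto simp: branches_def intro: suffix_in_omega_seqs)
qed

text \<open>Nullness rather than smallness of \<open>X n\<close> is assumed because its tree may
  start at any node of length \<open>n\<close>, so a witness is required for the section at each
  such node.\<close>

lemma U_small_UN_of_U_null:
  fixes X :: "nat \<Rightarrow> (nat \<Rightarrow> 'a) set"
  assumes U: "ultrafilter_over K U" and X: "\<And>n. U_null K U (X n)"
  shows "U_small K U (\<Union>n. X n)"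
proof -
  \<comment> \<open>The membership condition stands under the quantifier over trees so that choice
    yields a total function; its values off \<open>lists K\<close> are arbitrary.\<close>
  have "\<forall>n \<sigma>. \<exists>T. \<sigma> \<in> lists K \<longrightarrow>
      U_branching K U T \<and> branches K T \<inter> section_at K (X n) \<sigma> = {}"
    using X by (auto simp: U_null_def U_small_def)
  then obtain T where T: "\<And>n \<sigma>. \<sigma> \<in> lists K \<Longrightarrow> U_branching K U (T n \<sigma>)"
    and disj: "\<And>n \<sigma>. \<sigma> \<in> lists K \<Longrightarrow> branches K (T n \<sigma>) \<inter> section_at K (X n) \<sigma> = {}"
    unfolding choice_iff by blast
  have "s \<notin> X n" if s: "s \<in> branches K (fusion_tree K T)" for s n
  proof
    assume "s \<in> X n"
    have sK: "s \<in> omega_seqs K"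
      using s by (simp add: branches_def)
    \<comment> \<open>This holds because \<open>s\<close> is the concatenation of its first
      \<open>n\<close> entries with the remaining suffix.\<close>
    have "suffix n s \<in> section_at K (X n) (Omega_Words_Fun.prefix n s)"
      using \<open>s \<in> X n\<close> suffix_in_omega_seqs[OF sK] by (simp add: section_at_def)
    then show False
      using disj[OF prefix_in_lists[OF sK, of n], of n] suffix_in_branches_if_fusion_tree[OF s, of n]
      by blast
  qed
  moreover have "(\<Union>n. X n) \<subseteq> omega_seqs K"
    using X by (auto simp: U_null_def)
  ultimately show ?thesis
    using U_branching_fusion_tree[of K U T, OF U T] unfolding U_small_def by blast
qed

text \<open>Sections commute with unions and keep the members null, so the smallness result applies
  at every \<sigma>.\<close>

lemma U_null_UN:
  fixes X :: "nat \<Rightarrow> (nat \<Rightarrow> 'a) set"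
  assumes "ultrafilter_over K U" and X: "\<And>n. U_null K U (X n)"
  shows "U_null K U (\<Union>n. X n)"
proof -
  have "(\<Union>n. X n) \<subseteq> omega_seqs K"
    using X by (auto simp: U_null_def)
  moreover have "U_small K U (section_at K (\<Union>n. X n) \<sigma>)" if "\<sigma> \<in> lists K" for \<sigma>
    unfolding section_at_UN using assms that
    by (intro U_small_UN_of_U_null U_null_section_at)
  ultimately show ?thesis
    by (simp add: U_null_def)
qed

theorem theorem5p4:
  fixes \<kappa> :: "'a rel" and U :: "'a set set"
  assumes "Card_order \<kappa>"
    and "ultrafilter_over (Field \<kappa>) U"
  shows "sigma_ideal_on (omega_seqs (Field \<kappa>)) {X. U_null (Field \<kappa>) U X}"
  unfolding sigma_ideal_on_def
proof (intro conjI allI impI ballI)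
  show "{X. U_null (Field \<kappa>) U X} \<subseteq> Pow (omega_seqs (Field \<kappa>))"
    by (auto simp: U_null_def)
next
  fix X Y assume "X \<in> {X. U_null (Field \<kappa>) U X}" and "Y \<subseteq> X"
  then show "Y \<in> {X. U_null (Field \<kappa>) U X}"
    by (auto intro: U_null_subset)
next
  fix F assume F: "countable F \<and> F \<subseteq> {X. U_null (Field \<kappa>) U X}"
  \<comment> \<open>Inserting \<open>{}\<close> keeps the union and makes the family nonempty, so
    that it has an enumeration by the naturals even for empty \<open>F\<close>.\<close>
  let ?X = "from_nat_into (insert {} F)"
  have range: "range ?X = insert {} F"
    using F by (intro range_from_nat_into) auto
  have "U_null (Field \<kappa>) U (?X n)" for n
    using F U_null_empty[OF assms(2)] from_nat_into[of "insert {} F" n] by auto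
  then have "U_null (Field \<kappa>) U (\<Union>n. ?X n)"
    by (rule U_null_UN[OF assms(2)])
  then show "\<Union>F \<in> {X. U_null (Field \<kappa>) U X}"
    using range by simp
qed

end
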